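(* For any finite graph $G$ on $n$ vertices, $B(G) = n-1$ if and only if $\Delta(G) = n-1$.
   Context: Bodyguards and Presidents is a two-player game on a finite simple graph $G$. One player controls a set of tokens called bodyguards, the other a single token called the president. First all bodyguards are placed on vertices (several may share a vertex), then the president is placed. The players then alternate turns, bodyguards first; on a player's turn, each token they control either moves to an adjacent vertex or stays put. The president is surrounded if every vertex of the open neighbourhood of the president's vertex is occupied by a bodyguard. The bodyguards win if there is a finite time after which, at the end of every bodyguard turn, the president is surrounded; otherwise the president wins. The bodyguard number $B(G)$ is the minimum number of bodyguards that guarantees a win for the bodyguards on $G$ (with $B(G)=0$ for the edgeless graph). $\Delta(G)$ denotes the maximum degree. *)

theory Defs
  imports "Graph_Theory.Digraph"
begin

text \<open>
  A finite simple graph is a \<^locale>\<open>graph\<close>: a finite symmetric digraph without loops and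
  parallel arcs. Each edge is represented by two opposite arcs, so the degree of a vertex is its
  out-degree.
\<close>

definition max_degree :: "('a, 'b) pre_digraph \<Rightarrow> nat" where
  "max_degree G = Max (out_degree G ` verts G)"

definition open_nbhd :: "('a, 'b) pre_digraph \<Rightarrow> 'a \<Rightarrow> 'a set" where
  "open_nbhd G v = {w \<in> verts G. v \<rightarrow>\<^bsub>G\<^esub> w}"

definition legal_move :: "('a, 'b) pre_digraph \<Rightarrow> 'a \<Rightarrow> 'a \<Rightarrow> bool" where
  "legal_move G u v \<longleftrightarrow> u = v \<or> v \<in> open_nbhd G u"

text \<open>
  \<open>p 0\<close> is the initial vertex of the president and \<open>p t\<close> the vertex after the president's
  \<open>t\<close>-th turn.
\<close>

definition president_play :: "('a, 'b) pre_digraph \<Rightarrow> (nat \<Rightarrow> 'a) \<Rightarrow> bool" where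
  "president_play G p \<longleftrightarrow> p 0 \<in> verts G \<and> (\<forall>t. legal_move G (p t) (p (Suc t)))"

text \<open>
  A strategy \<open>\<sigma>\<close> for \<open>k\<close> bodyguards maps the president positions seen so far to the
  positions of the bodyguards \<open>0, \<dots>, k - 1\<close>: \<open>\<sigma> []\<close> is the initial placement, made before
  the president is placed, and \<open>\<sigma> [p 0, \<dots>, p t]\<close> is the position at the end of the bodyguard
  turn that answers \<open>p t\<close>. The bodyguards' own past positions are determined by \<open>\<sigma>\<close> and the
  president's past positions, so they need not be part of the argument.
\<close>

type_synonym 'a strategy = "'a list \<Rightarrow> nat \<Rightarrow> 'a"

definition bodyguards_after :: "'a strategy \<Rightarrow> (nat \<Rightarrow> 'a) \<Rightarrow> nat \<Rightarrow> nat \<Rightarrow> 'a" where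
  "bodyguards_after \<sigma> p t = \<sigma> (map p [0..<t])"

definition legal_strategy :: "('a, 'b) pre_digraph \<Rightarrow> nat \<Rightarrow> 'a strategy \<Rightarrow> bool" where
  "legal_strategy G k \<sigma> \<longleftrightarrow>
     (\<forall>i<k. \<sigma> [] i \<in> verts G) \<and>
     (\<forall>p. president_play G p \<longrightarrow>
        (\<forall>t. \<forall>i<k. legal_move G (bodyguards_after \<sigma> p t i) (bodyguards_after \<sigma> p (Suc t) i)))"

definition surrounded :: "('a, 'b) pre_digraph \<Rightarrow> nat \<Rightarrow> (nat \<Rightarrow> 'a) \<Rightarrow> 'a \<Rightarrow> bool" where
  "surrounded G k b v \<longleftrightarrow> (\<forall>w \<in> open_nbhd G v. \<exists>i<k. b i = w)"

definition bodyguards_win :: "('a, 'b) pre_digraph \<Rightarrow> nat \<Rightarrow> bool" where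
  "bodyguards_win G k \<longleftrightarrow>
     (\<exists>\<sigma>. legal_strategy G k \<sigma> \<and>
        (\<forall>p. president_play G p \<longrightarrow>
           (\<exists>T. \<forall>t\<ge>T. surrounded G k (bodyguards_after \<sigma> p (Suc t)) (p t))))"

text \<open>
  On a finite graph the minimum exists, since one stationary bodyguard on every vertex wins. On an
  edgeless graph every vertex is vacuously surrounded, so the value is 0.
\<close>

definition bodyguard_number :: "('a, 'b) pre_digraph \<Rightarrow> nat" where
  "bodyguard_number G = (LEAST k. bodyguards_win G k)"

end

theory Submission
  imports Defs
begin

text \<open>
  If some vertex is adjacent to all others, the president sits there and forces \<open>n - 1\<close> guards;
  conversely, \<open>n - 1\<close> guards always keep the only unguarded vertex (the hole) under the president.

  If there is no such vertex, \<open>n - 2\<close> guards win. In a disconnected graph they keep one hole in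
  each of two components and let it follow the president. In a connected graph one hole stays under
  the president's vertex \<open>u\<close> and the other one, \<open>h\<close>, at a non-neighbour of \<open>u\<close>. When the
  president steps to \<open>w\<close> adjacent to \<open>h\<close>, a hole has to be moved to a non-neighbour of \<open>w\<close> by
  shifting guards along a path in \<open>G - w\<close>, which can only fail if the component of \<open>u\<close> in
  \<open>G - w\<close> lies in the neighbourhood of \<open>w\<close>. At most one \<open>w\<close> has this property for a given
  \<open>u\<close>, so the guards also keep \<open>h\<close> outside the neighbourhood of that \<open>w\<close>, and this stronger
  invariant is preserved.
\<close>

section \<open>Strategies from invariants\<close>

text \<open>The history is read latest vertex first, so the recursion removes the vertex being
  answered and \<open>length us\<close> is the index of the current turn.\<close>

primrec invariant_strategy ::
  "((nat \<Rightarrow> 'a) \<Rightarrow> (nat \<Rightarrow> 'a) \<Rightarrow> bool) \<Rightarrow> (nat \<Rightarrow> 'a \<Rightarrow> (nat \<Rightarrow> 'a) \<Rightarrow> bool) \<Rightarrow> (nat \<Rightarrow> 'a)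
    \<Rightarrow> 'a list \<Rightarrow> nat \<Rightarrow> 'a" where
  "invariant_strategy M J b [] = b"
| "invariant_strategy M J b (u # us) =
     (SOME b'. M (invariant_strategy M J b us) b' \<and> J (length us) u b')"

text \<open>Positions chosen one after another by \<open>SOME\<close> preserve \<open>J\<close>,
  because every president move has a legal reply restoring it. \<open>J\<close> may vary with the
  turn, which leaves room for preparation before turn \<open>T\<close>.\<close>

lemma bodyguards_win_invariant:
  fixes G :: "('a, 'b) pre_digraph" and k :: nat and J :: "nat \<Rightarrow> 'a \<Rightarrow> (nat \<Rightarrow> 'a) \<Rightarrow> bool"
  defines "M \<equiv> \<lambda>b b'. \<forall>i<k. legal_move G (b i) (b' i)"
  assumes init: "\<And>i. i < k \<Longrightarrow> b i \<in> verts G"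
    and first: "\<And>u. u \<in> verts G \<Longrightarrow> \<exists>b'. M b b' \<and> J 0 u b'"
    and step: "\<And>t u w c. J t u c \<Longrightarrow> legal_move G u w \<Longrightarrow> \<exists>c'. M c c' \<and> J (Suc t) w c'"
    and goal: "\<And>t u c. J t u c \<Longrightarrow> t \<ge> T \<Longrightarrow> surrounded G k c u"
  shows "bodyguards_win G k"
proof -
  define \<sigma> where "\<sigma> = (\<lambda>us. invariant_strategy M J b (rev us))"
  have \<sigma>_Suc: "bodyguards_after \<sigma> p (Suc t) =
      (SOME c. M (bodyguards_after \<sigma> p t) c \<and> J t (p t) c)" for p t
    by (simp add: bodyguards_after_def \<sigma>_def)
  have inv: "M (bodyguards_after \<sigma> p t) (bodyguards_after \<sigma> p (Suc t)) \<and>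
      J t (p t) (bodyguards_after \<sigma> p (Suc t))" if p: "president_play G p" for p t
  proof (induction t)
    case 0
    have "bodyguards_after \<sigma> p 0 = b"
      by (simp add: bodyguards_after_def \<sigma>_def)
    moreover have "p 0 \<in> verts G"
      using p by (simp add: president_play_def)
    ultimately have "\<exists>c. M (bodyguards_after \<sigma> p 0) c \<and> J 0 (p 0) c"
      using first by simp
    then show ?case
      unfolding \<sigma>_Suc by (rule someI_ex)
  next
    case (Suc t)
    have "legal_move G (p t) (p (Suc t))"
      using p by (simp add: president_play_def)
    with Suc have "\<exists>c. M (bodyguards_after \<sigma> p (Suc t)) c \<and> J (Suc t) (p (Suc t)) c"
      using step by blast
    then show ?case
      unfolding \<sigma>_Suc[of p "Suc t"] by (rule someI_ex)
  qed
  have "\<sigma> [] = b"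
    by (simp add: \<sigma>_def)
  then have "legal_strategy G k \<sigma>"
    using inv init by (auto simp: legal_strategy_def M_def)
  moreover have "\<forall>t\<ge>T. surrounded G k (bodyguards_after \<sigma> p (Suc t)) (p t)"
    if "president_play G p" for p
    using inv[OF that] goal by blast
  ultimately show ?thesis
    unfolding bodyguards_win_def by blast
qed

section \<open>Reachability inside a vertex set\<close>

text \<open>The restriction is on arcs, so the empty walk exists even at a vertex outside
  \<open>X\<close>; hence the membership hypothesis in \<open>reach_mem\<close>.\<close>

definition reach :: "('a, 'b) pre_digraph \<Rightarrow> 'a set \<Rightarrow> 'a \<Rightarrow> 'a \<Rightarrow> bool" where
  "reach G X = (\<lambda>x y. x \<in> X \<and> y \<in> X \<and> x \<rightarrow>\<^bsub>G\<^esub> y)\<^sup>*\<^sup>*"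

lemma reach_refl [simp]: "reach G X x x"
  by (simp add: reach_def)

lemma reach_trans: "reach G X x y \<Longrightarrow> reach G X y z \<Longrightarrow> reach G X x z"
  unfolding reach_def by (rule rtranclp_trans)

lemma reach_edge: "x \<rightarrow>\<^bsub>G\<^esub> y \<Longrightarrow> x \<in> X \<Longrightarrow> y \<in> X \<Longrightarrow> reach G X x y"
  unfolding reach_def by (rule r_into_rtranclp) simp

lemma reach_induct [consumes 1, case_names refl step]:
  assumes "reach G X a c"
    and "P a"
    and "\<And>y z. \<lbrakk>reach G X a y; y \<in> X; z \<in> X; y \<rightarrow>\<^bsub>G\<^esub> z; P y\<rbrakk> \<Longrightarrow> P z"
  shows "P c"
  using assms unfolding reach_def by (induction rule: rtranclp_induct) auto

lemma reach_mem: "reach G X x y \<Longrightarrow> x \<in> X \<Longrightarrow> y \<in> X"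
  by (induction rule: reach_induct) auto

text \<open>Cut the walk at its last visit to \<open>a\<close>; what follows never returns
  there.\<close>

lemma reach_first_step:
  assumes "reach G X a c" and "a \<noteq> c"
  shows "\<exists>y. a \<rightarrow>\<^bsub>G\<^esub> y \<and> y \<in> X - {a} \<and> reach G (X - {a}) y c"
  using assms
proof (induction rule: reach_induct)
  case refl
  then show ?case by simp
next
  case (step y z)
  show ?case
  proof (cases "a = y")
    case True
    with step.hyps step.prems show ?thesis by (intro exI[of _ z]) auto
  next
    case False
    then obtain x where "a \<rightarrow>\<^bsub>G\<^esub> x" "x \<in> X - {a}" "reach G (X - {a}) x y"
      using step.IH by blast
    moreover have "reach G (X - {a}) y z"
      using step.hyps step.prems False by (intro reach_edge) auto
    ultimately show ?thesis by (blast intro: reach_trans)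
  qed
qed

text \<open>Cut a walk from \<open>a\<close> to \<open>c\<close> at its last visit to
  \<open>{a, b}\<close>: the rest starts at one of the two and avoids the other. For holes at
  \<open>a\<close> and \<open>b\<close>, one of them can therefore travel to \<open>c\<close>
  without passing the other.\<close>

lemma reach_avoid_either:
  assumes "reach G Z a c" and "a \<noteq> b"
  shows "reach G (Z - {b}) a c \<or> reach G (Z - {a}) b c"
  using assms(1)
proof (induction rule: reach_induct)
  case refl
  show ?case by simp
next
  case (step y z)
  show ?case
  proof (cases "z = a \<or> z = b")
    case True
    then show ?thesis by auto
  next
    case z: False
    show ?thesis
    proof (cases "y = a \<or> y = b")
      case True
      with step.hyps z \<open>a \<noteq> b\<close> show ?thesis
        by (auto intro: reach_edge)
    next
      case False
      with step.hyps z have "reach G (Z - {b}) y z" "reach G (Z - {a}) y z"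
        by (auto intro: reach_edge)
      with step.IH show ?thesis by (blast intro: reach_trans)
    qed
  qed
qed

lemma (in graph) adj_sym: "x \<rightarrow>\<^bsub>G\<^esub> y \<Longrightarrow> y \<rightarrow>\<^bsub>G\<^esub> x"
  using sym_arcs unfolding symmetric_def by (meson symE)

lemma (in graph) reach_sym: "reach G X x y \<Longrightarrow> reach G X y x"
proof (induction rule: reach_induct)
  case refl
  show ?case by simp
next
  case (step y z)
  then show ?case by (meson adj_sym reach_edge reach_trans)
qed

section \<open>Moving holes\<close>

text \<open>
  When all guards on a path that starts at a hole step towards that hole, the hole moves to the other
  end of the path: holes travel arbitrary distances in a single turn. Only coverage of the non-holes
  is recorded, so guards need not be counted after the initial placement.
\<close>

definition hole_move :: "('a, 'b) pre_digraph \<Rightarrow> 'a set \<Rightarrow> 'a set \<Rightarrow> bool" where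
  "hole_move G H H' \<longleftrightarrow>
     (\<exists>f. (\<forall>x\<in>verts G. legal_move G x (f x)) \<and> verts G - H' \<subseteq> f ` (verts G - H))"

context graph
begin

declare adj_in_verts [dest]

lemma open_nbhd_iff: "w \<in> open_nbhd G v \<longleftrightarrow> v \<rightarrow>\<^bsub>G\<^esub> w"
  by (auto simp: open_nbhd_def)

lemma legal_move_iff: "legal_move G u v \<longleftrightarrow> u = v \<or> u \<rightarrow>\<^bsub>G\<^esub> v"
  by (simp add: legal_move_def open_nbhd_iff)

lemma legal_move_verts: "legal_move G u v \<Longrightarrow> u \<in> verts G \<Longrightarrow> v \<in> verts G"
  by (auto simp: legal_move_iff)

lemma hole_move_refl [simp]: "hole_move G H H"
  unfolding hole_move_def by (intro exI[of _ id]) (auto simp: legal_move_def)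

text \<open>Induction along the walk: its first step leads to \<open>y\<close>, the hole is taken
  from \<open>y\<close> to \<open>c\<close> inside \<open>X - {a}\<close>, and the guard on
  \<open>y\<close> fills \<open>a\<close>.\<close>

lemma shift_along_reach:
  assumes "finite X" and "a \<in> X" and "reach G X a c"
  shows "\<exists>f. (\<forall>x\<in>X. f x \<in> X \<and> legal_move G x (f x)) \<and> X - {c} \<subseteq> f ` (X - {a})"
  using assms
proof (induction X arbitrary: a rule: finite_psubset_induct)
  case (psubset X)
  show ?case
  proof (cases "a = c")
    case True
    then show ?thesis by (intro exI[of _ id]) (auto simp: legal_move_def)
  next
    case False
    with psubset.prems obtain y where
      y: "a \<rightarrow>\<^bsub>G\<^esub> y" "y \<in> X - {a}" "reach G (X - {a}) y c"
      using reach_first_step by metis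
    moreover have "X - {a} \<subset> X"
      using psubset.prems by blast
    ultimately obtain f where
      f: "\<forall>x\<in>X - {a}. f x \<in> X - {a} \<and> legal_move G x (f x)"
        "X - {a} - {c} \<subseteq> f ` (X - {a} - {y})"
      using psubset.IH[of "X - {a}" y] by blast
    \<comment> \<open>\<open>y\<close> is the hole of the smaller problem, so no coverage depends on
      \<open>f y\<close> and it can be redirected to \<open>a\<close>. The value at the hole
      \<open>a\<close> only has to be a legal move inside \<open>X\<close>.\<close>
    define g where "g = f(a := a, y := a)"
    have "\<forall>x\<in>X. g x \<in> X \<and> legal_move G x (g x)"
      using f(1) y psubset.prems adj_sym[OF y(1)] by (auto simp: g_def legal_move_iff)
    moreover have "X - {c} \<subseteq> g ` (X - {a})"
    proof
      fix x assume x: "x \<in> X - {c}"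
      show "x \<in> g ` (X - {a})"
      proof (cases "x = a")
        case True
        then have "x = g y" by (simp add: g_def)
        with y(2) show ?thesis by blast
      next
        case False
        with x f(2) obtain x' where "x' \<in> X - {a} - {y}" "x = f x'" by blast
        then have "x = g x'" "x' \<in> X - {a}" by (auto simp: g_def)
        then show ?thesis by blast
      qed
    qed
    ultimately show ?thesis by blast
  qed
qed

lemma hole_move_one:
  assumes "a \<in> verts G" and "reach G (verts G) a c"
  shows "hole_move G {a} {c}"
  using shift_along_reach[OF finite_verts assms] unfolding hole_move_def by blast

lemma hole_move_two:
  assumes "X \<subseteq> verts G" "Y \<subseteq> verts G" "X \<inter> Y = {}"
    and "a \<in> X" "reach G X a c" and "b \<in> Y" "reach G Y b d"
  shows "hole_move G {a, b} {c, d}"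
proof -
  have fin: "finite X" "finite Y"
    using assms finite_subset finite_verts by blast+
  obtain f where f: "\<forall>x\<in>X. f x \<in> X \<and> legal_move G x (f x)" "X - {c} \<subseteq> f ` (X - {a})"
    using shift_along_reach[OF fin(1) assms(4,5)] by blast
  obtain g where g: "\<forall>x\<in>Y. g x \<in> Y \<and> legal_move G x (g x)" "Y - {d} \<subseteq> g ` (Y - {b})"
    using shift_along_reach[OF fin(2) assms(6,7)] by blast
  define h where "h = (\<lambda>x. if x \<in> X then f x else if x \<in> Y then g x else x)"
  have "\<forall>x\<in>verts G. legal_move G x (h x)"
    using f g by (auto simp: h_def legal_move_def)
  moreover have "verts G - {c, d} \<subseteq> h ` (verts G - {a, b})"
  proof
    fix x assume x: "x \<in> verts G - {c, d}"
    consider "x \<in> X" | "x \<in> Y" | "x \<notin> X \<union> Y" by blast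
    then show "x \<in> h ` (verts G - {a, b})"
    proof cases
      case 1
      with x f(2) obtain x' where "x' \<in> X - {a}" "x = f x'" by blast
      with assms have "x = h x'" "x' \<in> verts G - {a, b}" by (auto simp: h_def)
      then show ?thesis by blast
    next
      case 2
      with x g(2) obtain x' where "x' \<in> Y - {b}" "x = g x'" by blast
      with assms have "x = h x'" "x' \<in> verts G - {a, b}" by (auto simp: h_def)
      then show ?thesis by blast
    next
      case 3
      with x assms have "x = h x" "x \<in> verts G - {a, b}" by (auto simp: h_def)
      then show ?thesis by blast
    qed
  qed
  ultimately show ?thesis
    unfolding hole_move_def by blast
qed

lemma bodyguards_win_holes:
  fixes I :: "nat \<Rightarrow> 'a \<Rightarrow> 'a set \<Rightarrow> bool"
  assumes first: "\<And>u. u \<in> verts G \<Longrightarrow> \<exists>H'. hole_move G H H' \<and> I 0 u H'"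
    and step: "\<And>t u w H. I t u H \<Longrightarrow> legal_move G u w \<Longrightarrow> \<exists>H'. hole_move G H H' \<and> I (Suc t) w H'"
    and goal: "\<And>t u H. I t u H \<Longrightarrow> t \<ge> T \<Longrightarrow> open_nbhd G u \<inter> H = {}"
  shows "bodyguards_win G (card (verts G - H))"
proof -
  define k where "k = card (verts G - H)"
  obtain b where b: "bij_betw b {0..<k} (verts G - H)"
    using ex_bij_betw_nat_finite[of "verts G - H"] by (auto simp: k_def)
  then have b_img: "b ` {..<k} = verts G - H"
    by (simp add: bij_betw_def lessThan_atLeast0)
  \<comment> \<open>Only coverage is kept: surplus guards, even on holes, do no harm, since every
    guard at \<open>x\<close> simply moves to \<open>f x\<close>.\<close>
  define C where "C = (\<lambda>H c. (\<forall>i<k. c i \<in> verts G) \<and> verts G - H \<subseteq> c ` {..<k})"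
  have move: "\<exists>c'. (\<forall>i<k. legal_move G (c i) (c' i)) \<and> C H' c'"
    if "C H c" and "hole_move G H H'" for H H' c
  proof -
    from that(2) obtain f where f: "\<forall>x\<in>verts G. legal_move G x (f x)"
      "verts G - H' \<subseteq> f ` (verts G - H)"
      unfolding hole_move_def by blast
    have "verts G - H' \<subseteq> (\<lambda>i. f (c i)) ` {..<k}"
      using f(2) that(1) unfolding C_def by (fastforce simp: image_iff subset_iff)
    moreover have "\<forall>i<k. legal_move G (c i) (f (c i))"
      using f(1) that(1) by (simp add: C_def)
    ultimately show ?thesis
      using that(1) legal_move_verts by (intro exI[of _ "\<lambda>i. f (c i)"]) (auto simp: C_def)
  qed
  have "bodyguards_win G k"
  proof (rule bodyguards_win_invariant[where J = "\<lambda>t u c. \<exists>H. I t u H \<and> C H c" and b = b and T = T])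
    show "b i \<in> verts G" if "i < k" for i
      using b_img that by blast
    have "C H b"
      using b_img by (auto simp: C_def)
    then show "\<exists>b'. (\<forall>i<k. legal_move G (b i) (b' i)) \<and> (\<exists>H. I 0 u H \<and> C H b')"
      if "u \<in> verts G" for u
      using first[OF that] move by blast
    show "\<exists>c'. (\<forall>i<k. legal_move G (c i) (c' i)) \<and> (\<exists>H. I (Suc t) w H \<and> C H c')"
      if "\<exists>H. I t u H \<and> C H c" "legal_move G u w" for t u w c
    proof -
      from that(1) obtain H where "I t u H" "C H c" by blast
      moreover from step[OF this(1) that(2)] obtain H' where "hole_move G H H'" "I (Suc t) w H'"
        by blast
      ultimately show ?thesis using move by blast
    qed
    show "surrounded G k c u" if J: "\<exists>H. I t u H \<and> C H c" and "T \<le> t" for t u c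
    proof -
      from J obtain H where "I t u H" "C H c" by blast
      then have "open_nbhd G u \<inter> H = {}" "verts G - H \<subseteq> c ` {..<k}"
        using goal \<open>T \<le> t\<close> by (simp_all add: C_def)
      moreover have "open_nbhd G u \<subseteq> verts G"
        by (auto simp: open_nbhd_def)
      ultimately have "open_nbhd G u \<subseteq> c ` {..<k}" by blast
      then show ?thesis
        by (auto simp: surrounded_def)
    qed
  qed
  then show ?thesis by (simp add: k_def)
qed

section \<open>A dominating vertex\<close>

text \<open>A president who never leaves \<open>v\<close> must at some time see all neighbours
  occupied, and these need distinct guards.\<close>

lemma bodyguards_win_card_ge_degree:
  assumes "bodyguards_win G k" and "v \<in> verts G"
  shows "card (open_nbhd G v) \<le> k"
proof -
  have "president_play G (\<lambda>_. v)"
    using assms by (simp add: president_play_def legal_move_def)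
  with assms(1) obtain c where "surrounded G k c v"
    unfolding bodyguards_win_def by blast
  then have "open_nbhd G v \<subseteq> c ` {..<k}"
    by (auto simp: surrounded_def)
  then have "card (open_nbhd G v) \<le> card (c ` {..<k})"
    by (intro card_mono) auto
  also have "\<dots> \<le> k"
    using card_image_le[of "{..<k}" c] by simp
  finally show ?thesis .
qed

lemma dominating_vertex_bodyguards_win:
  assumes v: "v \<in> verts G" and dom: "\<And>y. y \<in> verts G \<Longrightarrow> y \<noteq> v \<Longrightarrow> v \<rightarrow>\<^bsub>G\<^esub> y"
  shows "bodyguards_win G (card (verts G) - 1)"
proof -
  have "bodyguards_win G (card (verts G - {v}))"
  \<comment> \<open>From \<open>v\<close> the hole reaches any starting vertex along at most one
    edge; afterwards it copies each president move.\<close>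
  proof (rule bodyguards_win_holes[where I = "\<lambda>t u H. u \<in> verts G \<and> H = {u}" and T = 0])
    show "\<exists>H'. hole_move G {v} H' \<and> u \<in> verts G \<and> H' = {u}" if "u \<in> verts G" for u
      using that v dom[OF that] by (metis hole_move_one reach_edge reach_refl)
    show "\<exists>H'. hole_move G H H' \<and> w \<in> verts G \<and> H' = {w}"
      if "u \<in> verts G \<and> H = {u}" "legal_move G u w" for u w H
      using that by (metis hole_move_one reach_edge reach_refl legal_move_iff legal_move_verts)
    show "open_nbhd G u \<inter> H = {}" if "u \<in> verts G \<and> H = {u}" for u H
      using that adj_not_same by (auto simp: open_nbhd_iff)
  qed
  with v show ?thesis by (simp add: card_Diff_singleton)
qed

section \<open>Disconnected graphs\<close>

lemma disconnected_bodyguards_win: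
  assumes ab: "a \<in> verts G" "b \<in> verts G" and nreach: "\<not> reach G (verts G) a b"
  shows "bodyguards_win G (card (verts G) - 2)"
proof -
  define A where "A = {y. reach G (verts G) a y}"
  define B where "B = {y. reach G (verts G) b y}"
  have sub: "A \<subseteq> verts G" "B \<subseteq> verts G"
    using ab reach_mem by (fastforce simp: A_def B_def)+
  have disj: "A \<inter> B = {}"
    using nreach reach_sym reach_trans by (fastforce simp: A_def B_def)
  have closed: "y \<in> A \<longleftrightarrow> x \<in> A" "y \<in> B \<longleftrightarrow> x \<in> B" if "x \<rightarrow>\<^bsub>G\<^esub> y" for x y
  proof -
    have "reach G (verts G) x y"
      using that by (intro reach_edge) auto
    then show "y \<in> A \<longleftrightarrow> x \<in> A" "y \<in> B \<longleftrightarrow> x \<in> B"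
      unfolding A_def B_def mem_Collect_eq by (meson reach_sym reach_trans)+
  qed
  \<comment> \<open>A walk from \<open>r\<close> never leaves the component of \<open>r\<close>. The
    two holes thus have routes inside the disjoint sets \<open>A\<close> and \<open>B\<close>, as
    \<open>hole_move_two\<close> requires.\<close>
  have reach_comp: "reach G {y. reach G (verts G) r y} r y" if "reach G (verts G) r y" for r y
    using that
  proof (induction rule: reach_induct)
    case refl
    show ?case by simp
  next
    case (step y z)
    then have "reach G {y. reach G (verts G) r y} y z"
      by (intro reach_edge) (auto intro: reach_trans reach_edge)
    with step.IH show ?case by (rule reach_trans)
  qed
  have conn: "reach G A x y" if "x \<in> A" "y \<in> A" for x y
    using reach_trans[OF reach_sym] reach_comp[of a x] reach_comp[of a y] that
    unfolding A_def mem_Collect_eq by blast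
  have conn': "reach G B x y" if "x \<in> B" "y \<in> B" for x y
    using reach_trans[OF reach_sym] reach_comp[of b x] reach_comp[of b y] that
    unfolding B_def mem_Collect_eq by blast
  \<comment> \<open>If the president is in neither \<open>A\<close> nor \<open>B\<close>, the holes
    may be anywhere in their components, since neither can be adjacent to the president.\<close>
  define I where "I = (\<lambda>u H. \<exists>x\<in>A. \<exists>y\<in>B. H = {x, y} \<and> (u \<in> A \<longrightarrow> x = u) \<and> (u \<in> B \<longrightarrow> y = u))"
  have move: "\<exists>H'. hole_move G {x, y} H' \<and> I w H'" if xy: "x \<in> A" "y \<in> B" for x y w
  proof -
    let ?x = "if w \<in> A then w else x" and ?y = "if w \<in> B then w else y"
    have "hole_move G {x, y} {?x, ?y}"
      using xy sub disj conn conn' by (intro hole_move_two[of A B]) auto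
    moreover have "I w {?x, ?y}"
      unfolding I_def using xy by (intro bexI[of _ ?x] bexI[of _ ?y]) auto
    ultimately show ?thesis by blast
  qed
  have in_ab: "a \<in> A" "b \<in> B" "a \<noteq> b"
    using nreach by (auto simp: A_def B_def)
  have "bodyguards_win G (card (verts G - {a, b}))"
  proof (rule bodyguards_win_holes[where I = "\<lambda>t. I" and T = 0])
    show "\<exists>H'. hole_move G {a, b} H' \<and> I u H'" for u
      using move in_ab by blast
    show "\<exists>H'. hole_move G H H' \<and> I w H'" if "I u H" for u w H
    proof -
      from that obtain x y where "x \<in> A" "y \<in> B" "H = {x, y}"
        unfolding I_def by blast
      with move show ?thesis by blast
    qed
    show "open_nbhd G u \<inter> H = {}" if "I u H" for u H
      using that closed adj_not_same unfolding I_def by (fastforce simp: open_nbhd_iff)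
  qed
  with ab in_ab show ?thesis by (simp add: card_Diff_subset numeral_2_eq_2)
qed

section \<open>Dominated components\<close>

text \<open>The obstruction to relocating a hole after a president step from \<open>u\<close> to
  \<open>w\<close>: a hole leaving \<open>u\<close> and avoiding \<open>w\<close> meets only
  neighbours of \<open>w\<close>. The empty walk makes \<open>w\<close> adjacent to
  \<open>u\<close>.\<close>

definition dominated :: "'a \<Rightarrow> 'a \<Rightarrow> bool" where
  "dominated u w \<longleftrightarrow> u \<in> verts G \<and> u \<noteq> w \<and> (\<forall>y. reach G (verts G - {w}) u y \<longrightarrow> w \<rightarrow>\<^bsub>G\<^esub> y)"

text \<open>The last clause looks one move ahead: if the president steps to a \<open>w\<close> for
  which relocation from \<open>u\<close> is obstructed, \<open>h\<close> is already outside its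
  neighbourhood.\<close>

definition good_hole :: "'a \<Rightarrow> 'a \<Rightarrow> bool" where
  "good_hole u h \<longleftrightarrow> u \<in> verts G \<and> h \<in> verts G \<and> h \<noteq> u \<and> \<not> u \<rightarrow>\<^bsub>G\<^esub> h \<and>
     (\<forall>w. dominated u w \<longrightarrow> \<not> w \<rightarrow>\<^bsub>G\<^esub> h)"

lemma dominated_adj: "dominated u w \<Longrightarrow> w \<rightarrow>\<^bsub>G\<^esub> u"
  by (simp add: dominated_def)

lemma dominated_reach:
  assumes "dominated u z" and "reach G (verts G - {z}) u w"
  shows "dominated w z"
proof -
  have "w \<in> verts G - {z}"
    using assms reach_mem by (fastforce simp: dominated_def)
  with assms show ?thesis
    unfolding dominated_def by (blast intro: reach_trans)
qed

lemma dominated_neighbour: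
  assumes "dominated u z" and "u \<rightarrow>\<^bsub>G\<^esub> w" and "w \<noteq> z"
  shows "dominated w z"
  using assms by (intro dominated_reach[OF assms(1)] reach_edge) (auto simp: dominated_def)

end

section \<open>Connected graphs without a dominating vertex\<close>

locale connected_nondominated = graph +
  assumes connected: "\<And>x y. x \<in> verts G \<Longrightarrow> y \<in> verts G \<Longrightarrow> reach G (verts G) x y"
    and no_dominating: "\<And>v. v \<in> verts G \<Longrightarrow> \<exists>y\<in>verts G. y \<noteq> v \<and> \<not> v \<rightarrow>\<^bsub>G\<^esub> y"
begin

text \<open>Both vertices are adjacent to \<open>u\<close>, so each would dominate the other. Any
  \<open>y\<close> is reached from one of them avoiding the other, so \<open>w\<^sub>1\<close> would
  be adjacent to every other vertex, which \<open>no_dominating\<close> excludes.\<close>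

lemma dominated_unique:
  assumes 1: "dominated u w\<^sub>1" and 2: "dominated u w\<^sub>2"
  shows "w\<^sub>1 = w\<^sub>2"
proof (rule ccontr)
  assume ne: "w\<^sub>1 \<noteq> w\<^sub>2"
  have adj: "w\<^sub>1 \<rightarrow>\<^bsub>G\<^esub> u" "w\<^sub>2 \<rightarrow>\<^bsub>G\<^esub> u"
    using 1 2 dominated_adj by auto
  then have w: "w\<^sub>1 \<in> verts G" "w\<^sub>2 \<in> verts G" by auto
  have d: "dominated w\<^sub>2 w\<^sub>1" "dominated w\<^sub>1 w\<^sub>2"
    using dominated_neighbour 1 2 adj adj_sym ne by metis+
  obtain y where y: "y \<in> verts G" "y \<noteq> w\<^sub>1" "\<not> w\<^sub>1 \<rightarrow>\<^bsub>G\<^esub> y"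
    using no_dominating[OF w(1)] by blast
  have "reach G (verts G - {w\<^sub>2}) w\<^sub>1 y \<or> reach G (verts G - {w\<^sub>1}) w\<^sub>2 y"
    using reach_avoid_either connected w(1) y(1) ne by metis
  then show False
  proof
    assume "reach G (verts G - {w\<^sub>2}) w\<^sub>1 y"
    with d(2) have "w\<^sub>2 \<rightarrow>\<^bsub>G\<^esub> y"
      by (simp add: dominated_def)
    with d(1) y show False
      using dominated_neighbour dominated_adj by metis
  next
    assume "reach G (verts G - {w\<^sub>1}) w\<^sub>2 y"
    with d(1) y show False
      by (simp add: dominated_def)
  qed
qed

text \<open>The same walk argument for the pair \<open>u\<close>, \<open>w\<close> would make
  \<open>u\<close> adjacent to all other vertices.\<close>

lemma dominated_asym:
  assumes 1: "dominated u w" and 2: "dominated w u"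
  shows False
proof -
  have "u \<in> verts G" "u \<noteq> w"
    using 1 by (auto simp: dominated_def)
  then obtain y where y: "y \<in> verts G" "y \<noteq> u" "\<not> u \<rightarrow>\<^bsub>G\<^esub> y"
    using no_dominating by blast
  have "reach G (verts G - {w}) u y \<or> reach G (verts G - {u}) w y"
    using reach_avoid_either connected \<open>u \<in> verts G\<close> y(1) \<open>u \<noteq> w\<close> by metis
  then show False
  proof
    assume "reach G (verts G - {w}) u y"
    with 1 have "w \<rightarrow>\<^bsub>G\<^esub> y"
      by (simp add: dominated_def)
    with 2 y show False
      using dominated_neighbour dominated_adj by metis
  next
    assume "reach G (verts G - {u}) w y"
    with 2 y show False
      by (simp add: dominated_def)
  qed
qed

text \<open>As a neighbour of \<open>w\<close>, the vertex \<open>u\<close> would inherit the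
  domination by \<open>z\<close>; uniqueness then forces \<open>z = w\<close>.\<close>

lemma dominated_not_trans:
  assumes "dominated u w"
  shows "\<not> dominated w z"
proof
  assume z: "dominated w z"
  have "z \<noteq> u"
    using dominated_asym assms z by blast
  then have "dominated u z"
    using dominated_neighbour[OF z dominated_adj[OF assms]] by simp
  with assms have "z = w"
    by (rule dominated_unique[symmetric])
  with z show False
    by (simp add: dominated_def)
qed

text \<open>Since \<open>w\<close> does not dominate \<open>u\<close>, some non-neighbour
  \<open>y\<close> of \<open>w\<close> is reachable from \<open>u\<close> off \<open>w\<close>. One
  hole travels to \<open>y\<close>, and the other steps to \<open>w\<close>, which is adjacent to
  both holes.\<close>

lemma relocate_hole:
  assumes "u \<in> verts G" "h \<in> verts G" "h \<noteq> u" "u \<rightarrow>\<^bsub>G\<^esub> w" "w \<rightarrow>\<^bsub>G\<^esub> h" and "\<not> dominated u w"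
  shows "\<exists>h'. hole_move G {u, h} {w, h'} \<and> h' \<in> verts G \<and> h' \<noteq> w \<and> \<not> w \<rightarrow>\<^bsub>G\<^esub> h'"
proof -
  have w: "w \<in> verts G" "w \<noteq> u" "w \<noteq> h"
    using assms adj_not_same by auto
  obtain y where y: "reach G (verts G - {w}) u y" "\<not> w \<rightarrow>\<^bsub>G\<^esub> y"
    using assms w unfolding dominated_def by blast
  have y': "y \<in> verts G" "y \<noteq> w"
    using reach_mem[OF y(1)] assms w by auto
  have "hole_move G {u, h} {w, y}"
    using reach_avoid_either[OF y(1) assms(3)[symmetric]]
  proof
    assume "reach G (verts G - {w} - {h}) u y"
    then have "hole_move G {u, h} {y, w}"
      using assms w adj_sym[of w h] by (intro hole_move_two[of "verts G - {w} - {h}" "{h, w}"]) (auto intro: reach_edge)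
    then show ?thesis by (simp add: insert_commute)
  next
    assume "reach G (verts G - {w} - {u}) h y"
    then show ?thesis
      using assms w by (intro hole_move_two[of "{u, w}" "verts G - {w} - {u}"]) (auto intro: reach_edge)
  qed
  with y y' show ?thesis by blast
qed

text \<open>If \<open>h\<close> stops being good, then neither \<open>u\<close> nor \<open>w\<close>
  is dominated by any vertex. So a hole can be relocated, and any non-neighbour of \<open>w\<close>
  other than \<open>w\<close> itself is good.\<close>

lemma good_hole_step:
  assumes good: "good_hole u h" and move: "legal_move G u w"
  shows "\<exists>h'. hole_move G {u, h} {w, h'} \<and> good_hole w h'"
proof (cases "w = u")
  case True
  with good hole_move_refl show ?thesis by blast
next
  case False
  with move have uw: "u \<rightarrow>\<^bsub>G\<^esub> w"
    by (simp add: legal_move_iff)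
  have V: "u \<in> verts G" "w \<in> verts G" "h \<in> verts G" "h \<noteq> u" "h \<noteq> w" "\<not> u \<rightarrow>\<^bsub>G\<^esub> h"
    using good uw by (auto simp: good_hole_def)
  show ?thesis
  proof (cases "good_hole w h")
    case True
    have "hole_move G {u, h} {w, h}"
      using V uw by (intro hole_move_two[of "{u, w}" "{h}"]) (auto intro: reach_edge)
    with True show ?thesis by blast
  next
    case bad: False
    \<comment> \<open>A dominator \<open>z\<close> of \<open>u\<close> would keep \<open>h\<close>
      good. If \<open>z = w\<close>, then \<open>w\<close> has no dominator and is not adjacent to
      \<open>h\<close>. Otherwise \<open>z\<close> dominates \<open>w\<close> too, and an edge from
      \<open>w\<close> to \<open>h\<close> would put \<open>h\<close> into the same dominated
      component.\<close>
    have not_dom_u: "\<not> dominated u z" for z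
    proof
      assume z: "dominated u z"
      then have zh: "\<not> z \<rightarrow>\<^bsub>G\<^esub> h"
        using good by (simp add: good_hole_def)
      show False
      proof (cases "z = w")
        case True
        with z zh bad V dominated_not_trans show False
          by (auto simp: good_hole_def)
      next
        case False
        then have w: "dominated w z"
          using dominated_neighbour z uw by blast
        have "h \<noteq> z"
          using V(6) dominated_adj[OF z] adj_sym by blast
        then have "\<not> w \<rightarrow>\<^bsub>G\<^esub> h"
          using dominated_neighbour[OF w] dominated_adj zh by blast
        with w zh bad V dominated_unique show False
          by (auto simp: good_hole_def)
      qed
    qed
    \<comment> \<open>A dominator of \<open>w\<close> other than \<open>u\<close> would also
      dominate \<open>u\<close>. If \<open>u\<close> dominates \<open>w\<close>, an edge from
      \<open>w\<close> to \<open>h\<close> would make \<open>h\<close> a neighbour of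
      \<open>u\<close>; so \<open>h\<close> would remain good.\<close>
    have not_dom_w: "\<not> dominated w z" for z
    proof
      assume z: "dominated w z"
      have zu: "z = u"
        using dominated_neighbour[OF z adj_sym[OF uw]] not_dom_u by blast
      have "\<not> w \<rightarrow>\<^bsub>G\<^esub> h"
        using dominated_neighbour[OF z] dominated_adj V zu by blast
      with z zu bad V dominated_unique show False
        by (auto simp: good_hole_def)
    qed
    have "w \<rightarrow>\<^bsub>G\<^esub> h"
      using bad V not_dom_w by (auto simp: good_hole_def)
    then obtain h' where "hole_move G {u, h} {w, h'}" "h' \<in> verts G" "h' \<noteq> w" "\<not> w \<rightarrow>\<^bsub>G\<^esub> h'"
      using relocate_hole[OF V(1,3,4) uw _ not_dom_u] by blast
    then show ?thesis
      using V not_dom_w by (auto simp: good_hole_def)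
  qed
qed

text \<open>If the president starts at \<open>z\<close> or at a vertex dominated by
  \<open>z\<close>, the hole at \<open>a\<close> comes through \<open>z\<close> and \<open>b\<close>
  stays; otherwise the hole at \<open>b\<close> comes and \<open>a\<close> stays. The invariant thus
  holds from turn 0.\<close>

lemma good_hole_first:
  assumes a: "dominated a z" and b: "b \<in> verts G" "b \<noteq> z" "\<not> z \<rightarrow>\<^bsub>G\<^esub> b" and u: "u \<in> verts G"
  shows "\<exists>h. hole_move G {a, b} {u, h} \<and> good_hole u h"
proof -
  have za: "z \<rightarrow>\<^bsub>G\<^esub> a" "a \<rightarrow>\<^bsub>G\<^esub> z"
    using dominated_adj[OF a] adj_sym by auto
  then have V: "z \<in> verts G" "a \<in> verts G" "a \<noteq> z"
    using adj_not_same by auto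
  have ab: "a \<noteq> b"
    using za b by auto
  show ?thesis
  proof (cases "u = z \<or> dominated u z")
    case True
    have zu: "u = z \<or> z \<rightarrow>\<^bsub>G\<^esub> u"
      using True dominated_adj by blast
    then have bu: "b \<noteq> u"
      using b by auto
    have "reach G {a, z, u} a z" "reach G {a, z, u} z u"
      using za zu by (auto intro: reach_edge)
    then have "reach G {a, z, u} a u"
      by (rule reach_trans)
    then have "hole_move G {a, b} {u, b}"
      using V u b bu ab by (intro hole_move_two[of "{a, z, u}" "{b}"]) auto
    moreover have "good_hole u b"
    proof (cases "u = z")
      case True
      with a b V dominated_not_trans show ?thesis
        by (auto simp: good_hole_def)
    next
      case False
      with True have uz: "dominated u z" by blast
      then have "\<not> u \<rightarrow>\<^bsub>G\<^esub> b"
        using dominated_neighbour[OF uz] dominated_adj b by blast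
      with uz b bu u show ?thesis
        using dominated_unique by (auto simp: good_hole_def)
    qed
    ultimately show ?thesis by blast
  next
    case False
    then have uz: "u \<noteq> z" "\<not> dominated u z" by auto
    \<comment> \<open>A walk from \<open>a\<close> to \<open>y\<close> off \<open>z\<close> would
      make \<open>y\<close> dominated by \<open>z\<close>, so there is a walk from \<open>z\<close>
      off \<open>a\<close>. Both \<open>b\<close> and \<open>u\<close> are such vertices
      \<open>y\<close>, which links them through \<open>z\<close>.\<close>
    have from_z: "reach G (verts G - {a}) z y" if "y \<in> verts G" "\<not> dominated y z" for y
      using reach_avoid_either[OF connected[OF V(1) that(1)] V(3)[symmetric]] dominated_reach[OF a] that(2)
      by blast
    have "\<not> dominated b z"
      using b dominated_adj by blast
    then have "reach G (verts G - {a}) b u"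
      using from_z b u uz reach_sym reach_trans by metis
    then have "hole_move G {b, a} {u, a}"
      using V ab b by (intro hole_move_two[of "verts G - {a}" "{a}"]) auto
    then have "hole_move G {a, b} {u, a}"
      by (simp add: insert_commute)
    moreover have "good_hole u a"
    proof -
      have "\<not> u \<rightarrow>\<^bsub>G\<^esub> a"
        using dominated_neighbour[OF a] adj_sym uz by blast
      \<comment> \<open>If \<open>w\<close> were adjacent to \<open>a\<close>, then \<open>z\<close>
        would dominate \<open>w\<close>, a chain excluded by
        \<open>dominated_not_trans\<close>.\<close>
      moreover have "\<not> w \<rightarrow>\<^bsub>G\<^esub> a" if w: "dominated u w" for w
        using dominated_neighbour[OF a] adj_sym dominated_not_trans[OF w] w uz by blast
      ultimately show ?thesis
        using V u a uz by (auto simp: good_hole_def)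
    qed
    ultimately show ?thesis by blast
  qed
qed

text \<open>Without dominated pairs, a hole off \<open>w\<close> can always be brought to a
  non-neighbour of \<open>w\<close>. So \<open>h\<close> need not be good beforehand: one reply to a
  president move sets up the invariant.\<close>

lemma good_hole_second:
  assumes free: "\<And>u w. \<not> dominated u w"
    and V: "u \<in> verts G" "h \<in> verts G" "h \<noteq> u" and move: "legal_move G u w"
  shows "\<exists>h'. hole_move G {u, h} {w, h'} \<and> good_hole w h'"
proof -
  have good: "good_hole w y \<longleftrightarrow> y \<in> verts G \<and> y \<noteq> w \<and> \<not> w \<rightarrow>\<^bsub>G\<^esub> y" for y
    using free legal_move_verts[OF move V(1)] by (auto simp: good_hole_def)
  have stay: "\<exists>h'. hole_move G {w, x} {w, h'} \<and> good_hole w h'" if x: "x \<in> verts G" "x \<noteq> w" for x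
  proof -
    obtain y where y: "reach G (verts G - {w}) x y" "\<not> w \<rightarrow>\<^bsub>G\<^esub> y"
      using free[of x w] x by (auto simp: dominated_def)
    then have "y \<in> verts G" "y \<noteq> w"
      using reach_mem[OF y(1)] x by auto
    moreover have "hole_move G {w, x} {w, y}"
      using y x legal_move_verts[OF move V(1)] by (intro hole_move_two[of "{w}" "verts G - {w}"]) auto
    ultimately show ?thesis
      using y good by blast
  qed
  consider "w = u" | "w = h" | "w \<noteq> u" "w \<noteq> h" "\<not> w \<rightarrow>\<^bsub>G\<^esub> h" | "w \<noteq> u" "w \<rightarrow>\<^bsub>G\<^esub> h" by blast
  then show ?thesis
  proof cases
    case 1
    with stay[of h] V show ?thesis by simp
  next
    \<comment> \<open>The president has stepped onto the second hole, so the two holes exchange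
      roles.\<close>
    case 2
    with stay[of u] V show ?thesis by (simp add: insert_commute)
  next
    case 3
    with move have "u \<rightarrow>\<^bsub>G\<^esub> w"
      by (simp add: legal_move_iff)
    with 3 V have "hole_move G {u, h} {w, h}"
      by (intro hole_move_two[of "{u, w}" "{h}"]) (auto intro: reach_edge)
    with 3 V good show ?thesis by blast
  next
    case 4
    with move have "u \<rightarrow>\<^bsub>G\<^esub> w"
      by (simp add: legal_move_iff)
    with relocate_hole[OF V this 4(2) free] good show ?thesis by blast
  qed
qed

lemma good_hole_surrounded: "good_hole u h \<Longrightarrow> open_nbhd G u \<inter> {u, h} = {}"
  using adj_not_same by (auto simp: good_hole_def open_nbhd_iff)

lemma bodyguards_win_two_holes:
  assumes "verts G \<noteq> {}"
  shows "bodyguards_win G (card (verts G) - 2)"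
proof (cases "\<exists>a z. dominated a z")
  case True
  then obtain a z where a: "dominated a z" by blast
  then have "z \<rightarrow>\<^bsub>G\<^esub> a"
    by (rule dominated_adj)
  then have V: "z \<in> verts G" "a \<in> verts G" by auto
  obtain b where b: "b \<in> verts G" "b \<noteq> z" "\<not> z \<rightarrow>\<^bsub>G\<^esub> b"
    using no_dominating[OF V(1)] by blast
  have "bodyguards_win G (card (verts G - {a, b}))"
  proof (rule bodyguards_win_holes[where I = "\<lambda>t u H. \<exists>h. H = {u, h} \<and> good_hole u h" and T = 0])
    show "\<exists>H'. hole_move G {a, b} H' \<and> (\<exists>h. H' = {u, h} \<and> good_hole u h)"
      if "u \<in> verts G" for u
      using good_hole_first[OF a b that] by blast
    show "\<exists>H'. hole_move G H H' \<and> (\<exists>h. H' = {w, h} \<and> good_hole w h)"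
      if "\<exists>h. H = {u, h} \<and> good_hole u h" "legal_move G u w" for u w H
      using that good_hole_step by metis
    show "open_nbhd G u \<inter> H = {}" if "\<exists>h. H = {u, h} \<and> good_hole u h" for u H
      using that good_hole_surrounded by metis
  qed
  moreover have "a \<noteq> b"
    using \<open>z \<rightarrow>\<^bsub>G\<^esub> a\<close> b by blast
  ultimately show ?thesis
    using V b by (simp add: card_Diff_subset numeral_2_eq_2)
next
  case False
  then have free: "\<not> dominated u w" for u w by blast
  obtain a b where ab: "a \<in> verts G" "b \<in> verts G" "a \<noteq> b"
    using assms no_dominating by (metis all_not_in_conv)
  \<comment> \<open>The first turn only brings a hole under the president; \<open>good_hole\<close>
    is demanded from turn 1 on, once \<open>good_hole_second\<close> has supplied it.\<close>
  let ?I = "\<lambda>t u H. \<exists>h. H = {u, h} \<and> u \<in> verts G \<and> h \<in> verts G \<and> h \<noteq> u \<and>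
    (t \<ge> 1 \<longrightarrow> good_hole u h)"
  have "bodyguards_win G (card (verts G - {a, b}))"
  proof (rule bodyguards_win_holes[where I = ?I and T = 1])
    show "\<exists>H'. hole_move G {a, b} H' \<and> ?I (0::nat) u H'" if u: "u \<in> verts G" for u
      using reach_avoid_either[OF connected[OF ab(1) u] ab(3)]
    proof
      assume r: "reach G (verts G - {b}) a u"
      then have "hole_move G {a, b} {u, b}"
        using ab by (intro hole_move_two[of "verts G - {b}" "{b}"]) auto
      with ab u reach_mem[OF r] show ?thesis by auto
    next
      assume r: "reach G (verts G - {a}) b u"
      then have "hole_move G {b, a} {u, a}"
        using ab by (intro hole_move_two[of "verts G - {a}" "{a}"]) auto
      then have "hole_move G {a, b} {u, a}"
        by (simp add: insert_commute)
      with ab u reach_mem[OF r] show ?thesis by auto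
    qed
    show "\<exists>H'. hole_move G H H' \<and> ?I (Suc t) w H'" if "?I t u H" "legal_move G u w" for t u w H
    proof -
      from that(1) obtain h where "H = {u, h}" "u \<in> verts G" "h \<in> verts G" "h \<noteq> u" by blast
      with good_hole_second[OF free this(2-4) that(2)] show ?thesis
        by (auto simp: good_hole_def)
    qed
    show "open_nbhd G u \<inter> H = {}" if "?I t u H" "1 \<le> t" for t u H
      using that good_hole_surrounded by metis
  qed
  with ab show ?thesis by (simp add: card_Diff_subset numeral_2_eq_2)
qed

end

section \<open>The bodyguard number\<close>

context graph
begin

lemma out_degree_eq_card_open_nbhd: "out_degree G v = card (open_nbhd G v)"
proof -
  have "head G ` out_arcs G v = open_nbhd G v"
    by (auto simp: open_nbhd_iff arcs_ends_conv)
  moreover have "inj_on (head G) (out_arcs G v)"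
    using no_multi_arcs by (auto simp: inj_on_def arc_to_ends_def)
  ultimately show ?thesis
    unfolding out_degree_def by (metis card_image)
qed

lemma open_nbhd_subset: "open_nbhd G v \<subseteq> verts G - {v}"
  using adj_not_same by (auto simp: open_nbhd_iff)

lemma card_open_nbhd_eq_iff:
  assumes "v \<in> verts G"
  shows "card (open_nbhd G v) = card (verts G) - 1 \<longleftrightarrow> (\<forall>y\<in>verts G. y \<noteq> v \<longrightarrow> v \<rightarrow>\<^bsub>G\<^esub> y)"
proof -
  have "card (verts G - {v}) = card (verts G) - 1"
    using assms by (simp add: card_Diff_singleton)
  then have "card (open_nbhd G v) = card (verts G) - 1 \<longleftrightarrow> open_nbhd G v = verts G - {v}"
    using card_subset_eq[OF _ open_nbhd_subset[of v]] by (metis finite_Diff finite_verts)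
  also have "\<dots> \<longleftrightarrow> (\<forall>y\<in>verts G. y \<noteq> v \<longrightarrow> v \<rightarrow>\<^bsub>G\<^esub> y)"
    using open_nbhd_subset[of v] open_nbhd_iff[of _ v] by blast
  finally show ?thesis .
qed

lemma max_degree_eq_iff:
  assumes "verts G \<noteq> {}"
  shows "max_degree G = card (verts G) - 1 \<longleftrightarrow>
    (\<exists>v\<in>verts G. \<forall>y\<in>verts G. y \<noteq> v \<longrightarrow> v \<rightarrow>\<^bsub>G\<^esub> y)"
proof -
  have le: "out_degree G v \<le> card (verts G) - 1" if "v \<in> verts G" for v
    using card_mono[OF _ open_nbhd_subset[of v]] that
    by (simp add: out_degree_eq_card_open_nbhd card_Diff_singleton)
  have "max_degree G = card (verts G) - 1 \<longleftrightarrow> (\<exists>v\<in>verts G. out_degree G v = card (verts G) - 1)"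
    unfolding max_degree_def using assms le by (subst Max_eq_iff) (auto simp: image_iff eq_commute)
  then show ?thesis
    using card_open_nbhd_eq_iff by (simp add: out_degree_eq_card_open_nbhd)
qed

lemma bodyguard_number_eq_iff:
  assumes "verts G \<noteq> {}"
  shows "bodyguard_number G = card (verts G) - 1 \<longleftrightarrow>
    (\<exists>v\<in>verts G. \<forall>y\<in>verts G. y \<noteq> v \<longrightarrow> v \<rightarrow>\<^bsub>G\<^esub> y)"
proof
  assume "\<exists>v\<in>verts G. \<forall>y\<in>verts G. y \<noteq> v \<longrightarrow> v \<rightarrow>\<^bsub>G\<^esub> y"
  then obtain v where v: "v \<in> verts G" "\<forall>y\<in>verts G. y \<noteq> v \<longrightarrow> v \<rightarrow>\<^bsub>G\<^esub> y" by blast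
  show "bodyguard_number G = card (verts G) - 1"
    unfolding bodyguard_number_def
  proof (rule Least_equality)
    show "bodyguards_win G (card (verts G) - 1)"
      using v by (intro dominating_vertex_bodyguards_win) auto
    show "card (verts G) - 1 \<le> k" if "bodyguards_win G k" for k
      using bodyguards_win_card_ge_degree[OF that v(1)] card_open_nbhd_eq_iff[OF v(1)] v(2)
      by simp
  qed
next
  assume eq: "bodyguard_number G = card (verts G) - 1"
  show "\<exists>v\<in>verts G. \<forall>y\<in>verts G. y \<noteq> v \<longrightarrow> v \<rightarrow>\<^bsub>G\<^esub> y"
  proof (rule ccontr)
    assume nodom: "\<not> ?thesis"
    have "bodyguards_win G (card (verts G) - 2)"
    proof (cases "\<forall>x\<in>verts G. \<forall>y\<in>verts G. reach G (verts G) x y")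
      case True
      with nodom interpret connected_nondominated G
        by unfold_locales auto
      show ?thesis
        using assms by (rule bodyguards_win_two_holes)
    next
      case False
      then show ?thesis
        using disconnected_bodyguards_win by blast
    qed
    then have "bodyguard_number G \<le> card (verts G) - 2"
      unfolding bodyguard_number_def by (rule Least_le)
    \<comment> \<open>A single vertex would be dominating, so there are two; hence the truncated
      \<open>card (verts G) - 2\<close> is strictly below \<open>card (verts G) - 1\<close>.\<close>
    moreover obtain x y where "x \<in> verts G" "y \<in> verts G" "x \<noteq> y"
      using assms nodom by blast
    then have "card {x, y} \<le> card (verts G)" "card {x, y} = 2"
      using card_mono[OF finite_verts, of "{x, y}"] by simp_all
    ultimately show False
      using eq by simp
  qed
qed

end

theorem theorem2p2:
  fixes G :: "('a, 'b) pre_digraph" and n :: nat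
  assumes "graph G" and "card (verts G) = n"
  shows "int (bodyguard_number G) = int n - 1 \<longleftrightarrow> int (max_degree G) = int n - 1"
proof (cases "verts G = {}")
  case True
  \<comment> \<open>Here \<open>int n - 1\<close> is negative, so both equations are false.\<close>
  with assms(2) show ?thesis by auto
next
  case False
  interpret graph G by (fact assms(1))
  have "n \<ge> 1"
    using False assms(2) by (auto simp: Suc_le_eq card_gt_0_iff)
  then have "int m = int n - 1 \<longleftrightarrow> m = card (verts G) - 1" for m
    using assms(2) by linarith
  with bodyguard_number_eq_iff[OF False] max_degree_eq_iff[OF False] show ?thesis
    by simp
qed

end
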